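(* Let $(S_t)_{t\ge 0}$, $(O_t)_{t\ge 1}$ be a hidden Markov model with finite hidden state space $\{1,\dots,K\}$, transition matrix $\boldsymbol{A}\in\mathbb{R}^{K\times K}$ all of whose entries are non-zero, an initial distribution $\pi$, and real-valued observations $O_t$ with emission probability density functions $f_1,\dots,f_K:\mathbb{R}\to[0,\infty)$. Let $\pi^*$ be the stationary distribution of $\boldsymbol{A}$ (a row vector) and let $\mathbf{F}(o)=(f_1(o),\dots,f_K(o))^{\mathrm T}$ be the vector-valued emission function. For $\tau\in\mathbb{R}$ and $T\ge 1$ define the empirical distribution of $\{O_t\}_{t=1}^T$ by $$\hat F_T(\tau)=\frac1T\sum_{t=1}^T \mathbb{I}_{\{O_t\le \tau\}}.$$ Then for every $\tau\in\mathbb{R}$, $$\lim_{T\to+\infty}\hat F_T(\tau)=\pi^*\int_{-\infty}^{\tau}\mathbf{F}(o)\,\mathrm{d}o\qquad\text{almost surely.}$$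
   Context: A hidden Markov model (HMM) with states $\{1,\dots,K\}$ consists of a time-homogeneous Markov chain $(S_t)_{t\ge0}$ (the hidden states) with transition matrix $\boldsymbol{A}=(a_{ij})$, $a_{ij}=p(S_{t+1}=j\mid S_t=i)$, and initial distribution $\pi=(\pi_1,\dots,\pi_K)$ (row vector), $\pi_k=p(S_0=k)$, together with observations $O_t$ such that the conditional law of each $O_t$ given all the hidden states and all the other observations depends only on $S_t$ (so that, given the hidden states, the observations are conditionally independent). Given $S_t=k$, $O_t$ has probability density function $f_k$ on $\mathbb{R}$ (the emission function of state $k$), which does not depend on $t$. A stationary distribution of $\boldsymbol{A}$ is a row vector $\pi^*=(\pi_1^*,\dots,\pi_K^* )$ with non-negative entries summing to $1$ and $\pi^*\boldsymbol{A}=\pi^*$; it is unique when all entries of $\boldsymbol{A}$ are non-zero. Integrals of vector-valued functions are taken entrywise, so $\pi^*\int_{-\infty}^\tau\mathbf{F}(o)\,\mathrm{d}o=\sum_{k=1}^K\pi^*_k\int_{-\infty}^\tau f_k(o)\,\mathrm{d}o$. $\mathbb{I}_{\{c\}}$ equals $1$ if $c$ is true and $0$ otherwise. *)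

theory Defs
  imports "HOL-Probability.Probability"
begin

definition stochastic_matrix :: "real ^ 'k ^ 'k \<Rightarrow> bool" where
  "stochastic_matrix A \<longleftrightarrow> (\<forall>i j. 0 \<le> A $ i $ j) \<and> (\<forall>i. (\<Sum>j\<in>UNIV. A $ i $ j) = 1)"

definition stationary_distribution :: "real ^ 'k \<Rightarrow> real ^ 'k ^ 'k \<Rightarrow> bool" where
  "stationary_distribution p A \<longleftrightarrow>
     (\<forall>k. 0 \<le> p $ k) \<and> (\<Sum>k\<in>UNIV. p $ k) = 1 \<and> p v* A = p"

definition prob_density :: "(real \<Rightarrow> real) \<Rightarrow> bool" where
  "prob_density g \<longleftrightarrow>
     g \<in> borel_measurable borel \<and> (\<forall>x. 0 \<le> g x) \<and> (\<integral>\<^sup>+x. ennreal (g x) \<partial>lborel) = 1"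

locale finite_markov_chain = prob_space M
  for M :: "'a measure"
    and S :: "nat \<Rightarrow> 'a \<Rightarrow> 'k::finite"
    and A :: "real ^ 'k ^ 'k"
    and \<pi> :: "real ^ 'k" +
  assumes S_measurable: "\<And>t. S t \<in> measurable M (count_space UNIV)"
    and stochastic: "stochastic_matrix A"
    and initial: "\<And>k. \<P>(w in M. S 0 w = k) = \<pi> $ k"
    and markov: "\<And>t (s :: nat \<Rightarrow> 'k) j.
          \<P>(w in M. \<forall>u\<le>t. S u w = s u) > 0 \<Longrightarrow>
          \<P>(w in M. S (Suc t) w = j \<bar> \<forall>u\<le>t. S u w = s u) = A $ s t $ j"

text \<open>The sub-sigma-algebra generated by all hidden states and all observations other than the
  one at time t.  Observations start at time 1; the value of Obs at 0 plays no role.\<close>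

definition states_and_other_obs ::
  "'a measure \<Rightarrow> (nat \<Rightarrow> 'a \<Rightarrow> 'k) \<Rightarrow> (nat \<Rightarrow> 'a \<Rightarrow> real) \<Rightarrow> nat \<Rightarrow> 'a measure" where
  "states_and_other_obs M S Obs t = sigma (space M)
     ({S u -` C \<inter> space M | u C. True} \<union>
      {Obs u -` B \<inter> space M | u B. 1 \<le> u \<and> u \<noteq> t \<and> B \<in> sets borel})"

definition state_algebra :: "'a measure \<Rightarrow> (nat \<Rightarrow> 'a \<Rightarrow> 'k) \<Rightarrow> nat \<Rightarrow> 'a measure" where
  "state_algebra M S t = vimage_algebra (space M) (S t) (count_space UNIV)"

locale hidden_markov_model = finite_markov_chain M S A \<pi>
  for M :: "'a measure"
    and S :: "nat \<Rightarrow> 'a \<Rightarrow> 'k::finite"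
    and A :: "real ^ 'k ^ 'k"
    and \<pi> :: "real ^ 'k" +
  fixes Obs :: "nat \<Rightarrow> 'a \<Rightarrow> real"
    and f :: "'k \<Rightarrow> real \<Rightarrow> real"
  assumes Obs_measurable: "\<And>t. 1 \<le> t \<Longrightarrow> Obs t \<in> borel_measurable M"
    and emission_prob_density: "\<And>k. prob_density (f k)"
    and Obs_depends_on_state: "\<And>t B. 1 \<le> t \<Longrightarrow> B \<in> sets borel \<Longrightarrow>
          AE w in M.
            real_cond_exp M (states_and_other_obs M S Obs t) (\<lambda>v. indicator B (Obs t v)) w =
            real_cond_exp M (state_algebra M S t) (\<lambda>v. indicator B (Obs t v)) w"
    and emission: "\<And>t k B. 1 \<le> t \<Longrightarrow> B \<in> sets borel \<Longrightarrow> \<P>(w in M. S t w = k) > 0 \<Longrightarrow>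
          \<P>(w in M. Obs t w \<in> B \<bar> S t w = k) = (LINT x:B|lborel. f k x)"

definition emission_vector :: "('k \<Rightarrow> real \<Rightarrow> real) \<Rightarrow> real \<Rightarrow> real ^ 'k" where
  "emission_vector f x = (\<chi> k. f k x)"

definition entrywise_integral :: "real set \<Rightarrow> (real \<Rightarrow> real ^ 'k) \<Rightarrow> real ^ 'k" where
  "entrywise_integral X G = (\<chi> k. LINT x:X|lborel. G x $ k)"

definition empirical_cdf :: "(nat \<Rightarrow> 'a \<Rightarrow> real) \<Rightarrow> nat \<Rightarrow> real \<Rightarrow> 'a \<Rightarrow> real" where
  "empirical_cdf Obs T \<tau> w = 1 / real T * (\<Sum>t=1..T. of_bool (Obs t w \<le> \<tau>))"

end

theory Submission
  imports Defs "HOL-Library.Discrete_Functions"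
begin

text \<open>Let \<open>X\<^sub>t = 1{O\<^sub>t \<le> \<tau>} - c\<close> with \<open>c\<close> the claimed limit, and let \<open>g k\<close> be the mean of
  \<open>X\<^sub>t\<close> in state \<open>k\<close>. Conditioning one observation at a time gives
  \<open>E X\<^sub>s X\<^sub>t = E g(S\<^sub>s) g(S\<^sub>t)\<close> for \<open>s < t\<close>. Since \<open>g\<close> has mean zero under the stationary
  distribution and all entries of the transition matrix are at least some \<open>\<delta> > 0\<close>, this is at
  most \<open>(1 - \<delta>)\<close> to the power \<open>t - s\<close> in absolute value. The second moment of the sum of the
  first \<open>T\<close> terms is therefore \<open>O(T)\<close>, so the averages along the squares \<open>T = n\<^sup>2\<close> have summable
  second moments and tend to zero almost surely; boundedness of \<open>X\<^sub>t\<close> controls the gaps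
  between consecutive squares.\<close>

section \<open>A strong law from decaying correlations\<close>

text \<open>Appending the term \<open>X N\<close> to the partial sum adds its own square and twice
  its product with the earlier terms. The earlier correlations sum to at most a geometric series, so
  each of these three contributions costs at most \<open>C / (1 - r)\<close>, whatever
  \<open>N\<close> is.\<close>

lemma (in prob_space) expectation_sum_power2_le:
  fixes X :: "nat \<Rightarrow> 'a \<Rightarrow> real"
  assumes meas: "\<And>n. X n \<in> borel_measurable M"
    and bounded: "\<And>n w. \<bar>X n w\<bar> \<le> 1"
    and decay: "\<And>m n. \<bar>expectation (\<lambda>w. X m w * X (m + n) w)\<bar> \<le> C * r ^ n"
    and r: "0 \<le> r" "r < 1"
  shows "expectation (\<lambda>w. (\<Sum>i<N. X i w)\<^sup>2) \<le> 3 * (C / (1 - r)) * real N"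
proof (induction N)
  case 0
  then show ?case by simp
next
  case (Suc N)
  \<comment> \<open>The sign of \<open>C\<close> is forced by the decay bound at lag 0.\<close>
  have "0 \<le> \<bar>expectation (\<lambda>w. X 0 w * X (0 + 0) w)\<bar>"
    by simp
  also have "\<dots> \<le> C * r ^ 0"
    by (rule decay)
  finally have C: "0 \<le> C"
    by simp
  define D where "D = C / (1 - r)"
  have int_XX: "integrable M (\<lambda>w. X i w * X j w)" for i j
    using meas bounded
    by (intro integrable_const_bound[where B = 1]) (auto simp: abs_mult intro!: mult_le_one)
  have int_SX: "integrable M (\<lambda>w. (\<Sum>i<N. X i w) * X N w)"
    using int_XX by (simp add: sum_distrib_right)
  have int_SS: "integrable M (\<lambda>w. (\<Sum>i<N. X i w)\<^sup>2)"
    using int_XX by (simp add: power2_eq_square sum_product)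
  have "expectation (\<lambda>w. (\<Sum>i<N. X i w) * X N w) = (\<Sum>i<N. expectation (\<lambda>w. X i w * X N w))"
    using int_XX by (simp add: sum_distrib_right)
  also have "\<dots> \<le> (\<Sum>i<N. C * r ^ (N - i))"
  proof (rule sum_mono)
    fix i assume "i \<in> {..<N}"
    then show "expectation (\<lambda>w. X i w * X N w) \<le> C * r ^ (N - i)"
      using decay[of i "N - i"] by simp
  qed
  \<comment> \<open>Reversing the order of summation turns the lag \<open>N - i\<close> into
    \<open>Suc i\<close>.\<close>
  also have "\<dots> = C * (\<Sum>i<N. r ^ Suc i)"
    unfolding sum_distrib_left
    by (rule sum.reindex_bij_witness[where i = "\<lambda>i. N - Suc i" and j = "\<lambda>i. N - Suc i"])
      (auto simp: Suc_diff_Suc simp del: power_Suc)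
  also have "\<dots> \<le> C * (1 / (1 - r))"
  proof (rule mult_left_mono[OF _ C])
    have "(\<Sum>i<N. r ^ Suc i) \<le> (\<Sum>i<N. r ^ i)"
      using r by (intro sum_mono power_decreasing) auto
    also have "\<dots> \<le> 1 / (1 - r)"
      using r sum_le_suminf[of "\<lambda>i. r ^ i" "{..<N}"] by (simp add: suminf_geometric summable_geometric)
    finally show "(\<Sum>i<N. r ^ Suc i) \<le> 1 / (1 - r)" .
  qed
  finally have cross: "expectation (\<lambda>w. (\<Sum>i<N. X i w) * X N w) \<le> D"
    by (simp add: D_def)
  have "expectation (\<lambda>w. X N w * X N w) \<le> C"
    using decay[of N 0] by simp
  also have "C \<le> D"
    using C r by (simp add: D_def field_simps)
  finally have diag: "expectation (\<lambda>w. X N w * X N w) \<le> D" .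
  have "expectation (\<lambda>w. (\<Sum>i<Suc N. X i w)\<^sup>2) =
      expectation (\<lambda>w. (\<Sum>i<N. X i w)\<^sup>2 + 2 * ((\<Sum>i<N. X i w) * X N w) + X N w * X N w)"
    by (intro Bochner_Integration.integral_cong refl) (simp add: power2_eq_square algebra_simps)
  also have "\<dots> = expectation (\<lambda>w. (\<Sum>i<N. X i w)\<^sup>2) +
      2 * expectation (\<lambda>w. (\<Sum>i<N. X i w) * X N w) + expectation (\<lambda>w. X N w * X N w)"
    using int_SX int_SS int_XX by simp
  also have "\<dots> \<le> 3 * D * real N + 2 * D + D"
    using Suc cross diag by (simp add: D_def)
  also have "\<dots> = 3 * D * real (Suc N)"
    by (simp add: algebra_simps)
  finally show ?case
    by (simp only: D_def)
qed

text \<open>By monotone convergence the series of the squares has finite expectation. It therefore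
  converges almost surely, and its terms tend to zero.\<close>

lemma (in prob_space) AE_tendsto_0_of_summable_second_moments:
  fixes Y :: "nat \<Rightarrow> 'a \<Rightarrow> real"
  assumes int: "\<And>n. integrable M (\<lambda>w. (Y n w)\<^sup>2)"
    and sum: "summable (\<lambda>n. expectation (\<lambda>w. (Y n w)\<^sup>2))"
  shows "AE w in M. (\<lambda>n. Y n w) \<longlonglongrightarrow> 0"
proof -
  have [measurable]: "(\<lambda>w. (Y n w)\<^sup>2) \<in> borel_measurable M" for n
    using int by auto
  have "(\<integral>\<^sup>+w. (\<Sum>n. ennreal ((Y n w)\<^sup>2)) \<partial>M) = (\<Sum>n. \<integral>\<^sup>+w. ennreal ((Y n w)\<^sup>2) \<partial>M)"
    by (rule nn_integral_suminf) simp
  also have "\<dots> = (\<Sum>n. ennreal (expectation (\<lambda>w. (Y n w)\<^sup>2)))"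
    using int by (simp add: nn_integral_eq_integral)
  also have "\<dots> = ennreal (\<Sum>n. expectation (\<lambda>w. (Y n w)\<^sup>2))"
    using sum by (intro suminf_ennreal2) auto
  finally have "(\<integral>\<^sup>+w. (\<Sum>n. ennreal ((Y n w)\<^sup>2)) \<partial>M) \<noteq> \<infinity>"
    by simp
  then have "AE w in M. (\<Sum>n. ennreal ((Y n w)\<^sup>2)) \<noteq> \<infinity>"
    by (intro nn_integral_PInf_AE) auto
  then show ?thesis
  proof eventually_elim
    case (elim w)
    then have "summable (\<lambda>n. (Y n w)\<^sup>2)"
      by (intro summable_suminf_not_top) auto
    then have "(\<lambda>n. (Y n w)\<^sup>2) \<longlonglongrightarrow> 0"
      by (rule summable_LIMSEQ_zero)
    then have "(\<lambda>n. sqrt ((Y n w)\<^sup>2)) \<longlonglongrightarrow> sqrt 0"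
      by (rule tendsto_real_sqrt)
    then show ?case
      by (simp add: tendsto_rabs_zero_iff)
  qed
qed

text \<open>Past the square of \<open>k\<close> and before the next square there are at most
  \<open>2 * k\<close> further terms, each bounded by 1. Relative to the square of \<open>k\<close>
  they are negligible.\<close>

lemma averages_tendsto_0_of_squares:
  fixes x :: "nat \<Rightarrow> real"
  assumes bounded: "\<And>n. \<bar>x n\<bar> \<le> 1"
    and squares: "(\<lambda>n. (\<Sum>i<n\<^sup>2. x i) / real (n\<^sup>2)) \<longlonglongrightarrow> 0"
  shows "(\<lambda>N. (\<Sum>i<N. x i) / real N) \<longlonglongrightarrow> 0"
proof -
  \<comment> \<open>The first summand is the average up to a square; the second is the cost of the
    at most \<open>2 * n\<close> later terms, divided by the square of \<open>n\<close>.\<close>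
  define g where "g n = \<bar>(\<Sum>i<n\<^sup>2. x i) / real (n\<^sup>2)\<bar> + 2 / real n" for n
  have "g \<longlonglongrightarrow> 0 + 0"
    unfolding g_def by (intro tendsto_add tendsto_rabs_zero[OF squares] lim_const_over_n)
  moreover have "filterlim floor_sqrt sequentially sequentially"
    unfolding filterlim_at_top
    by (auto intro: eventually_mono[OF eventually_ge_at_top] le_floor_sqrtI)
  ultimately have lim: "(\<lambda>N. g (floor_sqrt N)) \<longlonglongrightarrow> 0 + 0"
    by (rule filterlim_compose)
  have bound: "\<bar>(\<Sum>i<N. x i) / real N\<bar> \<le> g (floor_sqrt N)" if "0 < N" for N
  proof -
    define k where "k = floor_sqrt N"
    have k: "0 < k" "k\<^sup>2 \<le> N" and "N < (Suc k)\<^sup>2"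
      using that Suc_floor_sqrt_power2_gt[of N] by (auto simp: k_def)
    then have N_k: "N - k\<^sup>2 \<le> 2 * k"
      by (simp add: power2_eq_square)
    have "(\<Sum>i<N. x i) = (\<Sum>i<k\<^sup>2. x i) + (\<Sum>i\<in>{k\<^sup>2..<N}. x i)"
      using k by (simp add: lessThan_atLeast0 sum.atLeastLessThan_concat)
    moreover have "\<bar>\<Sum>i\<in>{k\<^sup>2..<N}. x i\<bar> \<le> 2 * real k"
    proof -
      have "\<bar>\<Sum>i\<in>{k\<^sup>2..<N}. x i\<bar> \<le> (\<Sum>i\<in>{k\<^sup>2..<N}. 1)"
        using bounded by (intro order_trans[OF sum_abs] sum_mono) auto
      also have "\<dots> \<le> 2 * real k"
        using N_k by simp
      finally show ?thesis .
    qed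
    ultimately have "\<bar>\<Sum>i<N. x i\<bar> \<le> \<bar>\<Sum>i<k\<^sup>2. x i\<bar> + 2 * real k"
      by linarith
    \<comment> \<open>The denominator is lowered from \<open>N\<close> to the square of
      \<open>k\<close>, which is positive because \<open>N\<close> is.\<close>
    then have "\<bar>(\<Sum>i<N. x i) / real N\<bar> \<le> (\<bar>\<Sum>i<k\<^sup>2. x i\<bar> + 2 * real k) / real (k\<^sup>2)"
      using k that unfolding abs_divide abs_of_nat by (intro frac_le) auto
    also have "\<dots> = g k"
      using k by (simp add: g_def add_divide_distrib power2_eq_square)
    finally show ?thesis
      by (simp add: k_def)
  qed
  show ?thesis
  proof (rule Lim_null_comparison)
    show "\<forall>\<^sub>F N in sequentially. norm ((\<Sum>i<N. x i) / real N) \<le> g (floor_sqrt N)"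
      using eventually_gt_at_top[of 0] by eventually_elim (use bound in simp)
  qed (use lim in simp)
qed

text \<open>The average of \<open>N\<close> terms has second moment of order \<open>1 / N\<close>,
  which is not summable; restricted to squares \<open>N = n * n\<close> it becomes summable.\<close>

lemma (in prob_space) strong_law_of_correlation_decay:
  fixes X :: "nat \<Rightarrow> 'a \<Rightarrow> real"
  assumes meas: "\<And>n. X n \<in> borel_measurable M"
    and bounded: "\<And>n w. \<bar>X n w\<bar> \<le> 1"
    and decay: "\<And>m n. \<bar>expectation (\<lambda>w. X m w * X (m + n) w)\<bar> \<le> C * r ^ n"
    and r: "0 \<le> r" "r < 1"
  shows "AE w in M. (\<lambda>N. (\<Sum>i<N. X i w) / real N) \<longlonglongrightarrow> 0"
proof -
  define Y where "Y n w = (\<Sum>i<n\<^sup>2. X i w) / real (n\<^sup>2)" for n w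
  define K where "K = 3 * (C / (1 - r))"
  have int: "integrable M (\<lambda>w. (Y n w)\<^sup>2)" for n
  proof (rule integrable_const_bound[where B = 1])
    have "\<bar>\<Sum>i<n\<^sup>2. X i w\<bar> \<le> (\<Sum>i<n\<^sup>2. 1)" for w
      using bounded by (intro order_trans[OF sum_abs] sum_mono) auto
    then have "\<bar>Y n w\<bar> \<le> 1" for w
      unfolding Y_def abs_divide abs_of_nat by (intro divide_le_eq_1[THEN iffD2]) (auto simp: not_less)
    then show "AE w in M. norm ((Y n w)\<^sup>2) \<le> 1"
      by (simp add: abs_square_le_1)
    show "(\<lambda>w. (Y n w)\<^sup>2) \<in> borel_measurable M"
      unfolding Y_def using meas by measurable
  qed
  have bound: "expectation (\<lambda>w. (Y n w)\<^sup>2) \<le> K * inverse (real n ^ 2)" for n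
  proof -
    have "expectation (\<lambda>w. (Y n w)\<^sup>2) = expectation (\<lambda>w. (\<Sum>i<n\<^sup>2. X i w)\<^sup>2) / (real (n\<^sup>2))\<^sup>2"
      by (simp add: Y_def power_divide)
    also have "\<dots> \<le> (K * real (n\<^sup>2)) / (real (n\<^sup>2))\<^sup>2"
      by (unfold K_def, intro divide_right_mono expectation_sum_power2_le[OF meas bounded decay r]) simp
    also have "\<dots> = K * inverse (real n ^ 2)"
      \<comment> \<open>At \<open>n = 0\<close> both sides are 0, by the convention on division by
        zero.\<close>
      by (cases "n = 0") (simp_all add: power2_eq_square field_simps)
    finally show ?thesis .
  qed
  have "summable (\<lambda>n. K * inverse (real n ^ 2))"
    by (intro summable_mult inverse_power_summable) simp
  then have "summable (\<lambda>n. expectation (\<lambda>w. (Y n w)\<^sup>2))"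
  proof (rule summable_comparison_test')
    fix n show "norm (expectation (\<lambda>w. (Y n w)\<^sup>2)) \<le> K * inverse (real n ^ 2)"
      using bound[of n] by (simp only: real_norm_def abs_of_nonneg Bochner_Integration.integral_nonneg zero_le_power2)
  qed
  then have "AE w in M. (\<lambda>n. Y n w) \<longlonglongrightarrow> 0"
    by (intro AE_tendsto_0_of_summable_second_moments int)
  then show ?thesis
    unfolding Y_def by eventually_elim (rule averages_tendsto_0_of_squares[OF bounded])
qed

text \<open>Only the level sets of \<open>Z\<close> are required to be events, so \<open>Z\<close>
  may be a path of states or a pair of a state and a truth value, with no sigma-algebra chosen on
  its range.\<close>

lemma (in prob_space) expectation_finite_range:
  fixes \<phi> :: "'b \<Rightarrow> real"
  assumes "finite F"
    and range: "\<And>w. w \<in> space M \<Longrightarrow> Z w \<in> F"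
    and sets: "\<And>p. p \<in> F \<Longrightarrow> {w \<in> space M. Z w = p} \<in> events"
  shows "expectation (\<lambda>w. \<phi> (Z w)) = (\<Sum>p\<in>F. \<phi> p * \<P>(w in M. Z w = p))"
proof -
  have "expectation (\<lambda>w. \<phi> (Z w)) =
      expectation (\<lambda>w. \<Sum>p\<in>F. \<phi> p * indicator {w \<in> space M. Z w = p} w)"
  proof (rule Bochner_Integration.integral_cong[OF refl])
    fix w assume w: "w \<in> space M"
    have "(\<Sum>p\<in>F. \<phi> p * indicator {w \<in> space M. Z w = p} w) =
        (\<Sum>p\<in>F. if p = Z w then \<phi> p else 0)"
      using w by (intro sum.cong) auto
    then show "\<phi> (Z w) = (\<Sum>p\<in>F. \<phi> p * indicator {w \<in> space M. Z w = p} w)"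
      using range[OF w] \<open>finite F\<close> by simp
  qed
  also have "\<dots> = (\<Sum>p\<in>F. \<phi> p * \<P>(w in M. Z w = p))"
    using sets by (subst Bochner_Integration.integral_sum) (auto simp: emeasure_eq_measure)
  finally show ?thesis .
qed

section \<open>Correlation decay of the hidden chain\<close>

context finite_markov_chain
begin

text \<open>The Markov property with the denominator cleared. On a path of probability zero both
  sides vanish, so sums over all paths need no case distinction.\<close>

lemma prob_path_step:
  "\<P>(w in M. (\<forall>u\<le>t. S u w = s u) \<and> S (Suc t) w = j) =
     A $ s t $ j * \<P>(w in M. \<forall>u\<le>t. S u w = s u)"
proof (cases "\<P>(w in M. \<forall>u\<le>t. S u w = s u) > 0")
  case True
  from markov[OF this, of j] True show ?thesis
    by (simp add: cond_prob_def field_simps conj_commute)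
next
  case False
  note [measurable] = S_measurable
  have "\<P>(w in M. \<forall>u\<le>t. S u w = s u) = 0"
    using False by (simp add: not_less measure_le_0_iff)
  moreover have "\<P>(w in M. (\<forall>u\<le>t. S u w = s u) \<and> S (Suc t) w = j)
      \<le> \<P>(w in M. \<forall>u\<le>t. S u w = s u)"
    by (rule finite_measure_mono) auto
  ultimately show ?thesis
    by (simp add: measure_le_0_iff)
qed

text \<open>Conditioning on the whole path up to \<open>t\<close>, which takes finitely many values,
  replaces the last transition by the matrix acting on \<open>h\<close>. Since
  \<open>s \<le> t\<close>, the factor \<open>g (S s w)\<close> is a function of that path.\<close>

lemma expectation_step:
  fixes g h :: "'k \<Rightarrow> real"
  assumes "s \<le> t"
  shows "expectation (\<lambda>w. g (S s w) * h (S (Suc t) w)) =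
    expectation (\<lambda>w. g (S s w) * (\<Sum>j\<in>UNIV. A $ S t w $ j * h j))"
proof -
  note [measurable] = S_measurable
  \<comment> \<open>Paths are extensional functions, so that equality with \<open>Z w\<close> means
    agreement at the times up to \<open>t\<close> and the set of paths is finite.\<close>
  define F where "F = PiE {..t} (\<lambda>_. UNIV :: 'k set)"
  define Z where "Z w = restrict (\<lambda>u. S u w) {..t}" for w
  have F: "finite F" and Z: "Z w \<in> F" for w
    by (auto simp: F_def Z_def intro: finite_PiE)
  have Z_iff: "Z w = p \<longleftrightarrow> (\<forall>u\<le>t. S u w = p u)" if "p \<in> F" for w p
    using that by (auto simp: F_def Z_def fun_eq_iff PiE_def extensional_def)
  have "expectation (\<lambda>w. g (S s w) * h (S (Suc t) w)) =
      expectation (\<lambda>w. (\<lambda>(p, j). g (p s) * h j) (Z w, S (Suc t) w))"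
    using assms by (simp add: Z_def)
  also have "\<dots> = (\<Sum>(p, j)\<in>F \<times> UNIV. g (p s) * h j * \<P>(w in M. (Z w, S (Suc t) w) = (p, j)))"
    by (subst expectation_finite_range[where F = "F \<times> UNIV"])
      (auto simp: F Z Z_iff case_prod_unfold prod_eq_iff)
  also have "\<dots> = (\<Sum>p\<in>F. \<Sum>j\<in>UNIV. g (p s) * h j * (A $ p t $ j * \<P>(w in M. Z w = p)))"
    unfolding sum.cartesian_product[symmetric]
    by (intro sum.cong refl) (simp add: Z_iff prob_path_step)
  also have "\<dots> = (\<Sum>p\<in>F. g (p s) * (\<Sum>j\<in>UNIV. A $ p t $ j * h j) * \<P>(w in M. Z w = p))"
    by (simp add: sum_distrib_left sum_distrib_right mult_ac)
  also have "\<dots> = expectation (\<lambda>w. (\<lambda>p. g (p s) * (\<Sum>j\<in>UNIV. A $ p t $ j * h j)) (Z w))"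
    by (subst expectation_finite_range[where F = F]) (auto simp: F Z Z_iff)
  also have "\<dots> = expectation (\<lambda>w. g (S s w) * (\<Sum>j\<in>UNIV. A $ S t w $ j * h j))"
    using assms by (simp add: Z_def)
  finally show ?thesis .
qed

text \<open>Doeblin's argument: for a function with stationary mean zero one may subtract
  \<open>\<delta>\<close> times the stationary distribution from each row of the matrix without changing
  the product, and the reduced rows are nonnegative with sum \<open>1 - \<delta>\<close>.\<close>

lemma stationary_mean_zero_contraction:
  fixes h :: "'k \<Rightarrow> real"
  assumes p: "stationary_distribution p A"
    and minorization: "\<And>i j. \<delta> \<le> A $ i $ j" and "0 \<le> \<delta>"
    and mean: "(\<Sum>k\<in>UNIV. p $ k * h k) = 0"
    and h: "\<And>k. \<bar>h k\<bar> \<le> b"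
  shows "\<bar>\<Sum>j\<in>UNIV. A $ i $ j * h j\<bar> \<le> (1 - \<delta>) * b"
proof -
  have p_nonneg: "0 \<le> p $ k" and p_sum: "(\<Sum>k\<in>UNIV. p $ k) = 1" for k
    using p by (auto simp: stationary_distribution_def)
  have p_le: "p $ k \<le> 1" for k
    using member_le_sum[of k UNIV "\<lambda>k. p $ k"] p_nonneg p_sum by simp
  have nonneg: "0 \<le> A $ i $ j - \<delta> * p $ j" for j
    using mult_left_mono[OF p_le \<open>0 \<le> \<delta>\<close>, of j] minorization[of i j] by simp
  have "(\<Sum>j\<in>UNIV. A $ i $ j * h j) = (\<Sum>j\<in>UNIV. (A $ i $ j - \<delta> * p $ j) * h j)"
    using mean by (simp add: algebra_simps sum_subtractf flip: sum_distrib_left)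
  also have "\<bar>\<dots>\<bar> \<le> (\<Sum>j\<in>UNIV. (A $ i $ j - \<delta> * p $ j) * b)"
    using nonneg h
    by (intro order_trans[OF sum_abs] sum_mono) (auto simp: abs_mult intro!: mult_left_mono)
  also have "\<dots> = (1 - \<delta>) * b"
    using stochastic p_sum
    by (simp add: stochastic_matrix_def sum_subtractf flip: sum_distrib_left sum_distrib_right)
  finally show ?thesis .
qed

text \<open>Keeps the mean-zero condition alive when the matrix is applied repeatedly to
  \<open>h\<close>.\<close>

lemma stationary_mean_step:
  assumes "stationary_distribution p A"
  shows "(\<Sum>i\<in>UNIV. p $ i * (\<Sum>j\<in>UNIV. A $ i $ j * h j)) = (\<Sum>j\<in>UNIV. p $ j * h j)"
proof -
  have "(\<Sum>i\<in>UNIV. p $ i * A $ i $ j) = p $ j" for j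
    using assms by (simp add: stationary_distribution_def vector_matrix_mult_def vec_eq_iff)
  then have "(\<Sum>j\<in>UNIV. p $ j * h j) = (\<Sum>j\<in>UNIV. (\<Sum>i\<in>UNIV. p $ i * A $ i $ j) * h j)"
    by simp
  also have "\<dots> = (\<Sum>i\<in>UNIV. p $ i * (\<Sum>j\<in>UNIV. A $ i $ j * h j))"
    unfolding sum_distrib_left sum_distrib_right by (subst sum.swap) (simp add: mult_ac)
  finally show ?thesis by simp
qed

text \<open>Each transition is absorbed into \<open>h\<close>: the new function again has stationary
  mean zero, and its bound shrinks by the factor \<open>1 - \<delta>\<close>. Hence the induction
  varies \<open>h\<close> and \<open>b\<close>. Only uniform bounds enter, so the chain may start
  from any initial distribution.\<close>

lemma state_correlation_decay:
  fixes g h :: "'k \<Rightarrow> real"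
  assumes p: "stationary_distribution p A"
    and \<delta>: "\<And>i j. \<delta> \<le> A $ i $ j" "0 \<le> \<delta>"
    and g: "\<And>k. \<bar>g k\<bar> \<le> 1"
    and "\<And>k. \<bar>h k\<bar> \<le> b" "(\<Sum>k\<in>UNIV. p $ k * h k) = 0"
  shows "\<bar>expectation (\<lambda>w. g (S s w) * h (S (s + n) w))\<bar> \<le> (1 - \<delta>) ^ n * b"
  using assms(5,6)
proof (induction n arbitrary: h b)
  case 0
  note [measurable] = S_measurable
  have "\<bar>g k * h l\<bar> \<le> b" for k l
    using mult_mono[OF g[of k] 0(1)[of l]] by (simp add: abs_mult)
  moreover from this have "0 \<le> b"
    using abs_ge_zero order_trans by blast
  ultimately have "\<bar>expectation (\<lambda>w. g (S s w) * h (S s w))\<bar> \<le> expectation (\<lambda>w. b)"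
    by (intro order_trans[OF integral_abs_bound] integral_mono integrable_const_bound[where B = b]) auto
  then show ?case
    by (simp add: prob_space)
next
  case (Suc n)
  let ?Ah = "\<lambda>i. \<Sum>j\<in>UNIV. A $ i $ j * h j"
  have "\<bar>?Ah k\<bar> \<le> (1 - \<delta>) * b" for k
    by (intro stationary_mean_zero_contraction[OF p \<delta> Suc.prems(2,1)])
  moreover have "(\<Sum>k\<in>UNIV. p $ k * ?Ah k) = 0"
    using stationary_mean_step[OF p] Suc.prems(2) by simp
  ultimately have "\<bar>expectation (\<lambda>w. g (S s w) * ?Ah (S (s + n) w))\<bar> \<le> (1 - \<delta>) ^ n * ((1 - \<delta>) * b)"
    by (rule Suc.IH)
  then show ?case
    using expectation_step[of s "s + n" g h] by (simp add: mult_ac)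
qed

end

section \<open>Replacing observations by their conditional means\<close>

context hidden_markov_model
begin

lemma space_states_and_other_obs [simp]: "space (states_and_other_obs M S Obs t) = space M"
  by (simp add: states_and_other_obs_def space_measure_of_conv)

lemma sets_states_and_other_obs:
  "sets (states_and_other_obs M S Obs t) = sigma_sets (space M)
     ({S u -` C \<inter> space M | u C. True} \<union>
      {Obs u -` B \<inter> space M | u B. 1 \<le> u \<and> u \<noteq> t \<and> B \<in> sets borel})"
  unfolding states_and_other_obs_def by (rule sets_measure_of) auto

lemma state_measurable_states_and_other_obs:
  "S u \<in> measurable (states_and_other_obs M S Obs t) (count_space UNIV)"
  by (rule measurableI) (auto simp: sets_states_and_other_obs intro!: sigma_sets.Basic)

lemma obs_measurable_states_and_other_obs:
  assumes "1 \<le> u" "u \<noteq> t"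
  shows "Obs u \<in> borel_measurable (states_and_other_obs M S Obs t)"
proof (rule measurableI)
  fix B :: "real set" assume "B \<in> sets borel"
  with assms show "Obs u -` B \<inter> space (states_and_other_obs M S Obs t)
      \<in> sets (states_and_other_obs M S Obs t)"
    unfolding sets_states_and_other_obs space_states_and_other_obs
    by (intro sigma_sets.Basic UnI2) blast
qed simp

lemma subalgebra_states_and_other_obs: "subalgebra M (states_and_other_obs M S Obs t)"
  unfolding subalgebra_def sets_states_and_other_obs
  using measurable_sets[OF S_measurable] measurable_sets[OF Obs_measurable]
  by (auto intro!: sets.sigma_sets_subset)

lemma subalgebra_state_algebra: "subalgebra M (state_algebra M S t)"
  unfolding subalgebra_def state_algebra_def
  using measurable_sets[OF S_measurable] by (auto simp: sets_vimage_algebra2)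

text \<open>The emission law with the denominator cleared; for a state of probability zero both
  sides vanish.\<close>

lemma prob_state_and_obs:
  assumes "1 \<le> t" "B \<in> sets borel"
  shows "\<P>(w in M. S t w = k \<and> Obs t w \<in> B) = (LINT x:B|lborel. f k x) * \<P>(w in M. S t w = k)"
proof (cases "\<P>(w in M. S t w = k) > 0")
  case True
  from emission[OF assms this] True show ?thesis
    by (simp add: cond_prob_def field_simps conj_commute)
next
  case False
  note [measurable] = S_measurable
  have "\<P>(w in M. S t w = k) = 0"
    using False by (simp add: not_less measure_le_0_iff)
  moreover have "\<P>(w in M. S t w = k \<and> Obs t w \<in> B) \<le> \<P>(w in M. S t w = k)"
    by (rule finite_measure_mono) auto
  ultimately show ?thesis
    by (simp add: measure_le_0_iff)
qed

text \<open>Events of the state algebra are preimages of sets \<open>C\<close> of states. Over such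
  an event both integrals equal the sum over the states in \<open>C\<close> of emission mass times
  state probability, which characterizes the conditional expectation.\<close>

lemma cond_exp_obs_given_state:
  assumes t: "1 \<le> t" and B: "B \<in> sets borel"
  shows "AE w in M. real_cond_exp M (state_algebra M S t) (\<lambda>v. indicator B (Obs t v)) w =
    (LINT x:B|lborel. f (S t w) x)"
proof -
  interpret finite_measure_subalgebra M "state_algebra M S t"
    by unfold_locales (rule subalgebra_state_algebra)
  note [measurable] = S_measurable Obs_measurable[OF t] B
  let ?G = "\<lambda>k. LINT x:B|lborel. f k x"
  have integrable_state: "integrable M (\<lambda>w. g (S t w))" for g :: "'k \<Rightarrow> real"
    by (rule integrable_const_bound[where B = "\<Sum>k\<in>UNIV. \<bar>g k\<bar>"]) (auto intro!: member_le_sum[of "S t _" UNIV "\<lambda>k. \<bar>g k\<bar>"])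
  show ?thesis
  proof (rule real_cond_exp_charact)
    show "integrable M (\<lambda>v. indicator B (Obs t v) :: real)"
      by (rule integrable_const_bound[where B = 1]) (auto simp: indicator_def)
    show "integrable M (\<lambda>w. ?G (S t w))"
      by (rule integrable_state)
    have "S t \<in> measurable (state_algebra M S t) (count_space UNIV)"
      unfolding state_algebra_def by (rule measurable_vimage_algebra1) auto
    then show "(\<lambda>w. ?G (S t w)) \<in> borel_measurable (state_algebra M S t)"
      by (rule measurable_compose) simp
  next
    fix E assume "E \<in> sets (state_algebra M S t)"
    then obtain C where E: "E = S t -` C \<inter> space M"
      unfolding state_algebra_def by (auto simp: sets_vimage_algebra2)
    \<comment> \<open>The observation enters only through the truth value of
      \<open>Obs t w \<in> B\<close>, so the pair with the state has finite range.\<close>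
    have "(LINT w:E|M. indicator B (Obs t w)) =
        expectation (\<lambda>w. (\<lambda>(k, b). of_bool (k \<in> C \<and> b)) (S t w, Obs t w \<in> B))"
      unfolding set_lebesgue_integral_def
      by (rule Bochner_Integration.integral_cong) (auto simp: E indicator_def)
    also have "\<dots> = (\<Sum>p\<in>UNIV \<times> UNIV. (case p of (k, b) \<Rightarrow> of_bool (k \<in> C \<and> b)) *
        \<P>(w in M. (S t w, Obs t w \<in> B) = p))"
      by (rule expectation_finite_range) auto
    also have "\<dots> = (\<Sum>k\<in>UNIV. of_bool (k \<in> C) * \<P>(w in M. S t w = k \<and> Obs t w \<in> B))"
      unfolding sum.cartesian_product' UNIV_bool of_bool_def by simp
    also have "\<dots> = (\<Sum>k\<in>UNIV. of_bool (k \<in> C) * ?G k * \<P>(w in M. S t w = k))"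
      using prob_state_and_obs[OF t B] by (simp add: mult_ac)
    also have "\<dots> = expectation (\<lambda>w. (\<lambda>k. of_bool (k \<in> C) * ?G k) (S t w))"
      by (subst expectation_finite_range[where F = UNIV]) auto
    also have "\<dots> = (LINT w:E|M. ?G (S t w))"
      unfolding set_lebesgue_integral_def
      by (rule Bochner_Integration.integral_cong) (auto simp: E indicator_def)
    finally show "(LINT w:E|M. indicator B (Obs t w)) = (LINT w:E|M. ?G (S t w))" .
  qed
qed

text \<open>\<open>Z\<close> is known given all states and the other observations, so it can be
  pulled out of that conditional expectation. By the hidden Markov property what remains depends on
  \<open>S t\<close> only and is the emission mass of \<open>B\<close>.\<close>

lemma expectation_mult_obs:
  assumes t: "1 \<le> t" and B: "B \<in> sets borel"
    and Z: "Z \<in> borel_measurable (states_and_other_obs M S Obs t)"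
    and bounded: "\<And>w. \<bar>Z w\<bar> \<le> b"
  shows "expectation (\<lambda>w. Z w * (indicator B (Obs t w) - c)) =
    expectation (\<lambda>w. Z w * ((LINT x:B|lborel. f (S t w) x) - c))"
proof -
  let ?F = "states_and_other_obs M S Obs t" and ?G = "\<lambda>k. LINT x:B|lborel. f k x"
  interpret finite_measure_subalgebra M ?F
    by unfold_locales (rule subalgebra_states_and_other_obs)
  note [measurable] = S_measurable Obs_measurable[OF t] B
  have Z_M [measurable]: "Z \<in> borel_measurable M"
    by (rule measurable_from_subalg[OF subalg Z])
  have int_Z: "integrable M Z"
    using bounded by (intro integrable_const_bound[where B = b]) auto
  have int_ZI: "integrable M (\<lambda>w. Z w * indicator B (Obs t w))"
    using bounded by (intro integrable_const_bound[where B = b])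
      (auto simp: indicator_def intro: order_trans[OF abs_ge_zero bounded])
  have "AE w in M. real_cond_exp M ?F (\<lambda>v. indicator B (Obs t v)) w = ?G (S t w)"
    using Obs_depends_on_state[OF t B] cond_exp_obs_given_state[OF t B]
    by eventually_elim simp
  then have AE: "AE w in M. Z w * real_cond_exp M ?F (\<lambda>v. indicator B (Obs t v)) w = Z w * ?G (S t w)"
    by eventually_elim simp
  have [measurable]: "(\<lambda>w. ?G (S t w)) \<in> borel_measurable M"
    by (rule measurable_compose[OF S_measurable]) simp
  note intg = real_cond_exp_intg[OF int_ZI Z]
  have "integrable M (\<lambda>w. Z w * ?G (S t w))"
    by (rule integrable_cong_AE_imp[OF intg(1)]) (use AE in auto)
  moreover have "expectation (\<lambda>w. Z w * indicator B (Obs t w)) = expectation (\<lambda>w. Z w * ?G (S t w))"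
    using intg(2) integral_cong_AE[OF _ _ AE] by simp
  ultimately show ?thesis
    using int_Z int_ZI by (simp add: right_diff_distrib)
qed

text \<open>The observations are replaced one at a time: first the one at \<open>t\<close>, with the
  one at \<open>s\<close> as known factor because \<open>s\<close> and \<open>t\<close> differ, then
  the one at \<open>s\<close>, with a function of the state at \<open>t\<close> as known
  factor.\<close>

lemma expectation_obs_mult_obs:
  fixes c :: real
  assumes "1 \<le> s" "s < t" and B: "B \<in> sets borel" and G: "\<And>k. G k = (LINT x:B|lborel. f k x)"
  shows "expectation (\<lambda>w. (indicator B (Obs s w) - c) * (indicator B (Obs t w) - c)) =
    expectation (\<lambda>w. (G (S s w) - c) * (G (S t w) - c))"
proof -
  have t: "1 \<le> t"
    using assms by simp
  note [measurable] = B
  have "Obs s \<in> borel_measurable (states_and_other_obs M S Obs t)"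
    using assms by (intro obs_measurable_states_and_other_obs) auto
  then have "expectation (\<lambda>w. (indicator B (Obs s w) - c) * (indicator B (Obs t w) - c)) =
      expectation (\<lambda>w. (indicator B (Obs s w) - c) * (G (S t w) - c))"
    unfolding G
    by (intro expectation_mult_obs[OF t B, where b = "1 + \<bar>c\<bar>"]) (auto simp: indicator_def)
  also have "\<dots> = expectation (\<lambda>w. (G (S t w) - c) * (indicator B (Obs s w) - c))"
    by (simp add: mult.commute)
  also have "\<dots> = expectation (\<lambda>w. (G (S t w) - c) * (G (S s w) - c))"
    unfolding G[of "S s _"]
  proof (rule expectation_mult_obs[OF \<open>1 \<le> s\<close> B, where b = "\<Sum>k\<in>UNIV. \<bar>G k - c\<bar>"])
    show "(\<lambda>w. G (S t w) - c) \<in> borel_measurable (states_and_other_obs M S Obs s)"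
      by (rule measurable_compose[OF state_measurable_states_and_other_obs]) simp
  qed (auto intro: member_le_sum)
  finally show ?thesis
    by (simp add: mult.commute)
qed

end

section \<open>Convergence of the empirical distribution\<close>

lemma set_integral_prob_density_bounds:
  assumes "prob_density g" "B \<in> sets borel"
  shows "0 \<le> (LINT x:B|lborel. g x)" "(LINT x:B|lborel. g x) \<le> 1"
proof -
  have [measurable]: "g \<in> borel_measurable borel" and g: "\<And>x. 0 \<le> g x"
    and mass: "(\<integral>\<^sup>+x. ennreal (g x) \<partial>lborel) = 1"
    using assms by (auto simp: prob_density_def)
  have int: "integrable lborel g"
    using g mass by (intro integrableI_nonneg) auto
  have "integral\<^sup>L lborel g = 1"
    using g mass by (simp add: integral_eq_nn_integral)
  moreover have "(LINT x:B|lborel. g x) \<le> integral\<^sup>L lborel g"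
    unfolding set_lebesgue_integral_def
    using int g assms by (intro integral_mono integrable_mult_indicator) (auto simp: indicator_def)
  ultimately show "(LINT x:B|lborel. g x) \<le> 1"
    by simp
  show "0 \<le> (LINT x:B|lborel. g x)"
    unfolding set_lebesgue_integral_def using g by (intro Bochner_Integration.integral_nonneg) auto
qed

theorem theorem3p1:
  fixes M :: "'a measure"
    and S :: "nat \<Rightarrow> 'a \<Rightarrow> 'k::finite"
    and Obs :: "nat \<Rightarrow> 'a \<Rightarrow> real"
    and A :: "real ^ 'k ^ 'k"
    and \<pi> \<pi>s :: "real ^ 'k"
    and f :: "'k \<Rightarrow> real \<Rightarrow> real"
    and \<tau> :: real
  assumes "hidden_markov_model M S A \<pi> Obs f"
    and "\<And>i j. A $ i $ j \<noteq> 0"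
    and "stationary_distribution \<pi>s A"
  shows "AE w in M. (\<lambda>T. empirical_cdf Obs T \<tau> w)
           \<longlonglongrightarrow> \<pi>s \<bullet> entrywise_integral {..\<tau>} (emission_vector f)"
proof -
  interpret hidden_markov_model M S A \<pi> Obs f
    by fact
  define G where "G k = (LINT x:{..\<tau>}|lborel. f k x)" for k
  define c where "c = \<pi>s \<bullet> entrywise_integral {..\<tau>} (emission_vector f)"
  \<comment> \<open>The shift by \<open>Suc\<close> reconciles sums starting at 0 with observation
    times starting at 1.\<close>
  define X where "X t w = indicator {..\<tau>} (Obs (Suc t) w) - c" for t w
  define \<delta> where "\<delta> = Min (range (\<lambda>(i, j). A $ i $ j))"
  have \<pi>s: "0 \<le> \<pi>s $ k" "(\<Sum>k\<in>UNIV. \<pi>s $ k) = 1" for k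
    using assms(3) by (auto simp: stationary_distribution_def)
  have G: "0 \<le> G k" "G k \<le> 1" for k
    unfolding G_def by (auto intro: set_integral_prob_density_bounds emission_prob_density)
  have c_eq: "c = (\<Sum>k\<in>UNIV. \<pi>s $ k * G k)"
    by (simp add: c_def G_def inner_vec_def entrywise_integral_def emission_vector_def)
  have "c \<le> (\<Sum>k\<in>UNIV. \<pi>s $ k * 1)"
    unfolding c_eq using \<pi>s G by (intro sum_mono mult_left_mono) auto
  then have c: "0 \<le> c" "c \<le> 1"
    using \<pi>s G by (auto simp: c_eq intro!: sum_nonneg)
  have nonneg: "0 \<le> A $ i $ j" and row: "(\<Sum>j\<in>UNIV. A $ i $ j) = 1" for i j
    using stochastic by (auto simp: stochastic_matrix_def)
  have \<delta>_le: "\<delta> \<le> A $ i $ j" for i j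
    unfolding \<delta>_def by (intro Min_le) (auto intro: rev_image_eqI[of "(i, j)"])
  have "\<delta> \<in> range (\<lambda>(i, j). A $ i $ j)"
    unfolding \<delta>_def by (intro Min_in) auto
  then obtain i j where ij: "\<delta> = A $ i $ j"
    by auto
  \<comment> \<open>The minimum is attained, at an entry that is nonnegative and nonzero, hence
    positive, and at most its row sum 1. So the rate \<open>1 - \<delta>\<close> lies in the range
    from 0 up to but excluding 1.\<close>
  have \<delta>: "0 < \<delta>" "\<delta> \<le> 1"
    using nonneg[of i j] assms(2)[of i j] member_le_sum[of j UNIV "\<lambda>j. A $ i $ j"] nonneg row ij
    by (auto simp: less_le)
  have X_meas: "X t \<in> borel_measurable M" for t
    unfolding X_def using Obs_measurable[of "Suc t"] by measurable
  have X_bounded: "\<bar>X t w\<bar> \<le> 1" for t w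
    using c by (auto simp: X_def indicator_def)
  have decay: "\<bar>expectation (\<lambda>w. X s w * X (s + n) w)\<bar> \<le> 1 * (1 - \<delta>) ^ n" for s n
  \<comment> \<open>At lag 0 both factors contain the same observation, so it cannot be conditioned
    on the other; the trivial bound 1 suffices.\<close>
  proof (cases "n = 0")
    case True
    have "\<bar>X s w * X s w\<bar> \<le> 1" for w
      using mult_mono[OF X_bounded[of s w] X_bounded[of s w]] by simp
    then have "\<bar>expectation (\<lambda>w. X s w * X s w)\<bar> \<le> expectation (\<lambda>w. 1)"
      using X_meas
      by (intro order_trans[OF integral_abs_bound] integral_mono integrable_const_bound[where B = 1])
        auto
    then show ?thesis
      using True by (simp add: prob_space)
  next
    case False
    have g: "\<bar>G k - c\<bar> \<le> 1" for k
      using G[of k] c by auto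
    \<comment> \<open>The limit is identified here: \<open>c\<close> is exactly the stationary mean
      of \<open>G\<close>.\<close>
    have "(\<Sum>k\<in>UNIV. \<pi>s $ k * (G k - c)) = 0"
      using \<pi>s by (simp add: right_diff_distrib sum_subtractf c_eq flip: sum_distrib_right)
    then have "\<bar>expectation (\<lambda>w. (G (S (Suc s) w) - c) * (G (S (Suc s + n) w) - c))\<bar>
        \<le> (1 - \<delta>) ^ n * 1"
      by (intro state_correlation_decay[OF assms(3) \<delta>_le]) (use \<delta> g in auto)
    moreover have "expectation (\<lambda>w. X s w * X (s + n) w) =
        expectation (\<lambda>w. (G (S (Suc s) w) - c) * (G (S (Suc s + n) w) - c))"
      unfolding X_def using False
      by (subst expectation_obs_mult_obs[where G = G]) (auto simp: G_def)
    ultimately show ?thesis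
      by simp
  qed
  have "AE w in M. (\<lambda>T. (\<Sum>t<T. X t w) / real T) \<longlonglongrightarrow> 0"
    by (rule strong_law_of_correlation_decay[OF X_meas X_bounded decay]) (use \<delta> in auto)
  then have "AE w in M. (\<lambda>T. empirical_cdf Obs T \<tau> w) \<longlonglongrightarrow> c"
  proof eventually_elim
    case (elim w)
    \<comment> \<open>At \<open>T = 0\<close> the left side is 0 and the right side is
      \<open>- c\<close>, so the identity is only used eventually.\<close>
    have "(\<Sum>t<T. X t w) / real T = empirical_cdf Obs T \<tau> w - c" if "0 < T" for T
    proof -
      have "(\<Sum>t<T. X t w) = (\<Sum>t=1..T. of_bool (Obs t w \<le> \<tau>) - c)"
        by (rule sum.reindex_bij_witness[where i = "\<lambda>t. t - 1" and j = Suc])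
          (auto simp: X_def indicator_def)
      then show ?thesis
        using that by (simp add: empirical_cdf_def sum_subtractf field_simps)
    qed
    then have "(\<lambda>T. empirical_cdf Obs T \<tau> w - c) \<longlonglongrightarrow> 0"
      by (intro Lim_transform_eventually[OF elim] eventually_mono[OF eventually_gt_at_top[of 0]]) auto
    then show ?case
      by (simp add: LIM_zero_iff)
  qed
  then show ?thesis
    by (simp add: c_def)
qed

end
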